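(* Let $r \ge 2$ be an integer and $\mathbf{m} = [m_2, m_3, \ldots]$ a type. Let $\mathbf{S} = \sum_{\mathbf{n} \ge 0} C_{\mathbf{n}}\mathbf{t}^{\mathbf{n}}$ with $C_{\mathbf{n}} = \dfrac{(E_{\mathbf{n}}-1)!}{(V_{\mathbf{n}}-1)!\,\mathbf{n}!}$. Then $$[\mathbf{t}^{\mathbf{m}}]\mathbf{S}^r = \frac{r\,(r-2+E_{\mathbf{m}})!}{(r-2+V_{\mathbf{m}})!\,\mathbf{m}!} = \frac{r\,(r-1+2m_2+3m_3+4m_4+\cdots)!}{(r+m_2+2m_3+3m_4+\cdots)!\,m_2!\,m_3!\,m_4!\cdots}.$$
   Context: A type is a vector $\mathbf{m} = [m_2, m_3, \ldots]$ of nonnegative integers with finitely many nonzero entries; $\mathbf{t}^{\mathbf{m}} = \prod_{k\ge2} t_k^{m_k}$ in formal power series in $t_2, t_3, \ldots$; $\mathbf{m}! = \prod_k m_k!$; $V_{\mathbf{m}} = 2 + \sum_{k\ge2}(k-1)m_k$; $E_{\mathbf{m}} = 1 + \sum_{k\ge2} k m_k$. ($C_{\mathbf{n}}$ equals the number of roofed dissections of a convex polygon of type $\mathbf{n}$.) *)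

theory Defs
  imports Complex_Main "HOL-Library.Poly_Mapping"
begin

text \<open>
  Formal power series in commuting variables indexed by an arbitrary (possibly infinite) type
  \<open>'v\<close>: all functions from monomials, i.e. finitely supported exponent vectors, to coefficients.
\<close>

typedef ('v, 'a) mpow_series = "UNIV :: (('v \<Rightarrow>\<^sub>0 nat) \<Rightarrow> 'a) set"
  morphisms mcoeff Abs_mpow_series ..

setup_lifting type_definition_mpow_series

lemma mpow_series_eqI: "(\<And>m. mcoeff f m = mcoeff g m) \<Longrightarrow> f = g"
  by transfer auto

definition splits :: "('v \<Rightarrow>\<^sub>0 nat) \<Rightarrow> (('v \<Rightarrow>\<^sub>0 nat) \<times> ('v \<Rightarrow>\<^sub>0 nat)) set" where
  "splits m = {(a, b). a + b = m}"

lemma splits_iff [simp]: "(a, b) \<in> splits m \<longleftrightarrow> a + b = m"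
  by (simp add: splits_def)

lemma finite_splits [simp]: "finite (splits m)"
proof -
  define N where "N = (\<Sum>k\<in>Poly_Mapping.keys m. Poly_Mapping.lookup m k)"
  define A where "A = {a. \<exists>b. a + b = m}"
  have "Poly_Mapping.lookup ` A \<subseteq>
      {f. \<forall>x. (x \<in> Poly_Mapping.keys m \<longrightarrow> f x \<in> {..N}) \<and> (x \<notin> Poly_Mapping.keys m \<longrightarrow> f x = 0)}"
  proof clarify
    fix a x assume "a \<in> A"
    then have le: "Poly_Mapping.lookup a x \<le> Poly_Mapping.lookup m x" by (auto simp: A_def lookup_add)
    have "Poly_Mapping.lookup m x \<le> N" if "x \<in> Poly_Mapping.keys m"
      unfolding N_def using that by (intro member_le_sum) auto
    with le show "(x \<in> Poly_Mapping.keys m \<longrightarrow> Poly_Mapping.lookup a x \<in> {..N}) \<and>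
        (x \<notin> Poly_Mapping.keys m \<longrightarrow> Poly_Mapping.lookup a x = 0)"
      by (auto simp: in_keys_iff)
  qed
  then have "finite (Poly_Mapping.lookup ` A)"
    by (rule finite_subset) (rule finite_set_of_finite_funs; simp)
  then have "finite A"
    by (rule finite_imageD) (simp add: inj_on_def poly_mapping_eqI)
  moreover have "splits m \<subseteq> A \<times> A"
    by (auto simp: A_def) (metis add.commute)
  ultimately show ?thesis
    by (meson finite_SigmaI finite_subset)
qed

instantiation mpow_series :: (type, comm_ring_1) comm_ring_1
begin

lift_definition zero_mpow_series :: "('a, 'b) mpow_series" is "\<lambda>_. 0" .

lift_definition one_mpow_series :: "('a, 'b) mpow_series" is "\<lambda>m. if m = 0 then 1 else 0" .

lift_definition plus_mpow_series ::
  "('a, 'b) mpow_series \<Rightarrow> ('a, 'b) mpow_series \<Rightarrow> ('a, 'b) mpow_series"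
  is "\<lambda>f g m. f m + g m" .

lift_definition minus_mpow_series ::
  "('a, 'b) mpow_series \<Rightarrow> ('a, 'b) mpow_series \<Rightarrow> ('a, 'b) mpow_series"
  is "\<lambda>f g m. f m - g m" .

lift_definition uminus_mpow_series :: "('a, 'b) mpow_series \<Rightarrow> ('a, 'b) mpow_series"
  is "\<lambda>f m. - f m" .

lift_definition times_mpow_series ::
  "('a, 'b) mpow_series \<Rightarrow> ('a, 'b) mpow_series \<Rightarrow> ('a, 'b) mpow_series"
  is "\<lambda>f g m. \<Sum>(a, b)\<in>splits m. f a * g b" .

instance
proof
  fix f g h :: "('a, 'b) mpow_series"
  show "f * g * h = f * (g * h)"
  proof (rule mpow_series_eqI)
    fix m
    let ?F = "\<lambda>a b c. mcoeff f a * mcoeff g b * mcoeff h c"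
    have "mcoeff (f * g * h) m =
        (\<Sum>x\<in>splits m. \<Sum>y\<in>splits (fst x). ?F (fst y) (snd y) (snd x))"
      by (simp add: times_mpow_series.rep_eq case_prod_beta sum_distrib_right)
    also have "\<dots> = (\<Sum>(x, y)\<in>Sigma (splits m) (\<lambda>x. splits (fst x)). ?F (fst y) (snd y) (snd x))"
      by (rule sum.Sigma) auto
    also have "\<dots> = (\<Sum>(x, y)\<in>Sigma (splits m) (\<lambda>x. splits (snd x)). ?F (fst x) (fst y) (snd y))"
      by (rule sum.reindex_bij_witness[where
            i = "\<lambda>(x, y). ((fst x + fst y, snd y), (fst x, fst y))" and
            j = "\<lambda>(x, y). ((fst y, snd y + snd x), (snd y, snd x))"])
        (auto simp: splits_def add.assoc)
    also have "\<dots> = (\<Sum>x\<in>splits m. \<Sum>y\<in>splits (snd x). ?F (fst x) (fst y) (snd y))"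
      by (rule sum.Sigma[symmetric]) auto
    also have "\<dots> = mcoeff (f * (g * h)) m"
      by (simp add: times_mpow_series.rep_eq case_prod_beta sum_distrib_left mult.assoc)
    finally show "mcoeff (f * g * h) m = mcoeff (f * (g * h)) m" .
  qed
  show "f * g = g * f"
  proof (rule mpow_series_eqI)
    fix m
    show "mcoeff (f * g) m = mcoeff (g * f) m"
      unfolding times_mpow_series.rep_eq
      by (rule sum.reindex_bij_witness[where i = prod.swap and j = prod.swap])
        (auto simp: splits_def add.commute mult.commute)
  qed
  show "1 * f = f"
  proof (rule mpow_series_eqI)
    fix m
    have "mcoeff (1 * f) m = (\<Sum>(a, b)\<in>{(0, m)}. mcoeff 1 a * mcoeff f b)"
      unfolding times_mpow_series.rep_eq
      by (rule sum.mono_neutral_right) (auto simp: one_mpow_series.rep_eq split: if_splits)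
    then show "mcoeff (1 * f) m = mcoeff f m"
      by (simp add: one_mpow_series.rep_eq)
  qed
  show "(f + g) * h = f * h + g * h"
    by (rule mpow_series_eqI)
      (simp add: times_mpow_series.rep_eq plus_mpow_series.rep_eq case_prod_beta
        distrib_right sum.distrib)
  show "(0 :: ('a, 'b) mpow_series) \<noteq> 1"
  proof
    assume "(0 :: ('a, 'b) mpow_series) = 1"
    then have "mcoeff (0 :: ('a, 'b) mpow_series) 0 = mcoeff 1 0" by simp
    then show False by (simp add: zero_mpow_series.rep_eq one_mpow_series.rep_eq)
  qed
qed (transfer; simp add: algebra_simps fun_eq_iff)+

end

text \<open>
  A type $[m_2, m_3, \ldots]$ is the finitely supported vector \<open>m\<close> with \<open>lookup m k\<close> $= m_k$, whose
  entries at the unused indices 0 and 1 vanish. All sums and products over $k \ge 2$ thus run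
  over the finite support.
\<close>

definition is_type :: "(nat \<Rightarrow>\<^sub>0 nat) \<Rightarrow> bool" where
  "is_type m \<longleftrightarrow> Poly_Mapping.keys m \<subseteq> {2..}"

definition V :: "(nat \<Rightarrow>\<^sub>0 nat) \<Rightarrow> nat" where
  "V m = 2 + (\<Sum>k\<in>Poly_Mapping.keys m. (k - 1) * Poly_Mapping.lookup m k)"

definition E :: "(nat \<Rightarrow>\<^sub>0 nat) \<Rightarrow> nat" where
  "E m = 1 + (\<Sum>k\<in>Poly_Mapping.keys m. k * Poly_Mapping.lookup m k)"

definition type_fact :: "(nat \<Rightarrow>\<^sub>0 nat) \<Rightarrow> nat" where
  "type_fact m = (\<Prod>k\<in>Poly_Mapping.keys m. fact (Poly_Mapping.lookup m k))"

definition C :: "(nat \<Rightarrow>\<^sub>0 nat) \<Rightarrow> rat" where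
  "C n = fact (E n - 1) / (fact (V n - 1) * of_nat (type_fact n))"

text \<open>
  The variables $t_0$ and $t_1$ of the ambient ring do not occur in \<open>S\<close>.
\<close>

definition S :: "(nat, rat) mpow_series" where
  "S = Abs_mpow_series (\<lambda>n. if is_type n then C n else 0)"

end

theory Submission
  imports Defs
begin

text \<open>
  Write $e = \sum_k k\, m_k$ and $v = \sum_k (k-1) m_k$, and let
  $A_r(m) = r\,(r+e-1)! / ((r+v)!\, m!)$ be the claimed coefficient of $S^r$.
  A direct computation gives
  $A_{r+1}(m) = A_r(m) + \sum_k A_{r+k}(m - e_k)$, the coefficientwise form of
  $S^{r+1} = S^r (1 + \sum_k t_k S^k)$. This recurrence, by induction on the size of $m$ and then
  on $r$, yields the Rothe--Hagen convolution $A_r A_s = A_{r+s}$; since $A_1 = S$, it follows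
  that $A_r = S^r$.
\<close>

section \<open>Weights and factorials of exponent vectors\<close>

text \<open>Three instances matter: \<open>w k = k\<close> gives e = \<open>E m - 1\<close>,
  \<open>w k = k - 1\<close> gives v = \<open>V m - 2\<close>, and the constant 1 gives the total
  multiplicity n, which serves as induction measure.\<close>

definition weight :: "('a \<Rightarrow> nat) \<Rightarrow> ('a \<Rightarrow>\<^sub>0 nat) \<Rightarrow> nat" where
  "weight w m = (\<Sum>k\<in>Poly_Mapping.keys m. w k * Poly_Mapping.lookup m k)"

text \<open>Serves to compare vectors with different supports over one common index set; indices
  outside the support contribute 0.\<close>

lemma weight_superset:
  assumes "finite K" "Poly_Mapping.keys m \<subseteq> K"
  shows "weight w m = (\<Sum>k\<in>K. w k * Poly_Mapping.lookup m k)"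
  unfolding weight_def using assms
  by (intro sum.mono_neutral_left) (auto simp: in_keys_iff)

lemma type_fact_superset:
  assumes "finite K" "Poly_Mapping.keys m \<subseteq> K"
  shows "type_fact m = (\<Prod>k\<in>K. fact (Poly_Mapping.lookup m k))"
  unfolding type_fact_def using assms
  by (intro prod.mono_neutral_left) (auto simp: in_keys_iff)

lemma weight_0 [simp]: "weight w 0 = 0"
  by (simp add: weight_def)

lemma type_fact_0 [simp]: "type_fact 0 = 1"
  by (simp add: type_fact_def)

lemma type_fact_pos [simp]: "type_fact m > 0"
  by (auto simp: type_fact_def intro!: prod_pos)

lemma minus_single_add_single:
  fixes m :: "'a \<Rightarrow>\<^sub>0 nat"
  assumes "k \<in> Poly_Mapping.keys m"
  shows "m - Poly_Mapping.single k 1 + Poly_Mapping.single k 1 = m"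
  using assms
  by (intro poly_mapping_eqI)
    (auto simp: lookup_add lookup_minus lookup_single when_def in_keys_iff)

lemma weight_add: "weight w (a + b) = weight w a + weight w b"
proof -
  let ?K = "Poly_Mapping.keys a \<union> Poly_Mapping.keys b"
  have "Poly_Mapping.keys (a + b) \<subseteq> ?K"
    by (rule Poly_Mapping.keys_add)
  then show ?thesis
    by (simp add: weight_superset[of ?K] lookup_add distrib_left sum.distrib)
qed

lemma weight_single [simp]: "weight w (Poly_Mapping.single k n) = w k * n"
  by (simp add: weight_def)

lemma type_fact_add_single:
  "type_fact (m + Poly_Mapping.single k 1) = Suc (Poly_Mapping.lookup m k) * type_fact m"
proof -
  \<comment> \<open>The index \<open>k\<close> may be new to \<open>m\<close>; its factor in
    \<open>type_fact m\<close> is then 0! = 1.\<close>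
  let ?K = "insert k (Poly_Mapping.keys m)"
  have "Poly_Mapping.keys (m + Poly_Mapping.single k 1) \<subseteq> ?K"
    using Poly_Mapping.keys_add[of m "Poly_Mapping.single k 1"] by auto
  then have "type_fact (m + Poly_Mapping.single k 1) =
      (\<Prod>j\<in>?K. fact (Poly_Mapping.lookup (m + Poly_Mapping.single k 1) j))"
    by (simp only: type_fact_superset finite_insert finite_keys)
  also have "\<dots> = fact (Suc (Poly_Mapping.lookup m k)) *
      (\<Prod>j\<in>?K - {k}. fact (Poly_Mapping.lookup m j))"
    by (subst prod.remove[of _ k])
      (auto simp: lookup_add lookup_single when_def intro!: prod.cong)
  also have "\<dots> = Suc (Poly_Mapping.lookup m k) * (\<Prod>j\<in>?K. fact (Poly_Mapping.lookup m j))"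
    by (subst prod.remove[of ?K k]) (auto simp: algebra_simps)
  also have "(\<Prod>j\<in>?K. fact (Poly_Mapping.lookup m j)) = type_fact m"
    by (rule type_fact_superset[symmetric]) auto
  finally show ?thesis .
qed

text \<open>Natural exponents cannot cancel. Hence both parts of any split of a type are again
  types.\<close>

lemma keys_add_nat:
  fixes a b :: "'a \<Rightarrow>\<^sub>0 nat"
  shows "Poly_Mapping.keys (a + b) = Poly_Mapping.keys a \<union> Poly_Mapping.keys b"
  by (auto simp: in_keys_iff lookup_add)

lemma is_type_add: "is_type (a + b) \<longleftrightarrow> is_type a \<and> is_type b"
  by (simp add: is_type_def keys_add_nat)

text \<open>On a type every index is at least 2, so the truncated \<open>k - 1\<close> is a true
  predecessor. In terms of \<open>V\<close> and \<open>E\<close> this is Euler's relation V - E + n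
  = 1.\<close>

lemma weight_type:
  assumes "is_type m"
  shows "weight (\<lambda>k. k) m = weight (\<lambda>k. k - 1) m + weight (\<lambda>_. 1) m"
  unfolding weight_def sum.distrib[symmetric]
proof (rule sum.cong)
  fix k assume "k \<in> Poly_Mapping.keys m"
  with assms have "k = k - 1 + 1"
    by (auto simp: is_type_def)
  then show "k * Poly_Mapping.lookup m k =
      (k - 1) * Poly_Mapping.lookup m k + 1 * Poly_Mapping.lookup m k"
    by (metis distrib_right)
qed simp

section \<open>The recurrence in r\<close>

text \<open>
  The case \<open>m = 0\<close> is separated only for \<open>r = 0\<close>, where the general formula would give 0.
\<close>

definition pow_coeff :: "nat \<Rightarrow> (nat \<Rightarrow>\<^sub>0 nat) \<Rightarrow> rat" where
  "pow_coeff r m = (if m = 0 then 1 else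
     of_nat r * fact (r + weight (\<lambda>k. k) m - 1) /
       (fact (r + weight (\<lambda>k. k - 1) m) * of_nat (type_fact m)))"

text \<open>For \<open>m = 0\<close> the formula gives r (r-1)! / r! = 1, in agreement with the
  separated case.\<close>

lemma pow_coeff_pos:
  assumes "r > 0"
  shows "pow_coeff r m = of_nat r * fact (r + weight (\<lambda>k. k) m - 1) /
       (fact (r + weight (\<lambda>k. k - 1) m) * of_nat (type_fact m))"
  using assms by (cases r) (auto simp: pow_coeff_def)

lemma pow_coeff_0: "pow_coeff 0 m = (if m = 0 then 1 else 0)"
  by (simp add: pow_coeff_def)

text \<open>Removing one \<open>k\<close> lowers e by k and v by k - 1, while r grows by k. So r + e
  is unchanged and r + v grows by 1: the remaining quotient is the same for all
  \<open>k\<close>.\<close>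

lemma pow_coeff_minus_single:
  assumes "is_type m" "k \<in> Poly_Mapping.keys m"
  shows "pow_coeff (r + k) (m - Poly_Mapping.single k 1) =
    of_nat ((r + k) * Poly_Mapping.lookup m k) * (fact (r + weight (\<lambda>k. k) m - 1) /
      (fact (r + weight (\<lambda>k. k - 1) m + 1) * of_nat (type_fact m)))"
proof -
  define m' where "m' = m - Poly_Mapping.single k 1"
  have m: "m = m' + Poly_Mapping.single k 1"
    using minus_single_add_single[OF assms(2)] by (simp add: m'_def)
  \<comment> \<open>This makes \<open>r + k\<close> positive, so \<open>pow_coeff_pos\<close>
    applies even when \<open>r = 0\<close>.\<close>
  have k: "k \<ge> 2"
    using assms by (auto simp: is_type_def)
  have e: "r + weight (\<lambda>k. k) m - 1 = r + k + weight (\<lambda>k. k) m' - 1"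
    by (simp add: m weight_add)
  have v: "r + weight (\<lambda>k. k - 1) m + 1 = r + k + weight (\<lambda>k. k - 1) m'"
    using k by (simp add: m weight_add)
  have l: "Poly_Mapping.lookup m k = Suc (Poly_Mapping.lookup m' k)"
    by (simp add: m lookup_add)
  have t: "type_fact m = Poly_Mapping.lookup m k * type_fact m'"
    unfolding l by (simp only: m type_fact_add_single)
  have "Poly_Mapping.lookup m k \<noteq> 0"
    using l by simp
  then show ?thesis
    unfolding m'_def[symmetric] e v t using k
    by (subst pow_coeff_pos) (auto simp del: of_nat_Suc)
qed

text \<open>Every term is an integer multiple of the common quotient \<open>q\<close>, which leaves
  the identity (r+1)(r+e) = r(r+v+1) + (rn+e), true because e = v + n.\<close>

lemma pow_coeff_Suc:
  assumes "is_type m"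
  shows "pow_coeff (Suc r) m = pow_coeff r m +
    (\<Sum>k\<in>Poly_Mapping.keys m. pow_coeff (r + k) (m - Poly_Mapping.single k 1))"
proof (cases "m = 0")
  case False
  define e v n where "e = weight (\<lambda>k. k) m" and "v = weight (\<lambda>k. k - 1) m"
    and "n = weight (\<lambda>_. 1) m"
  define q :: rat where "q = fact (r + e - 1) / (fact (r + v + 1) * of_nat (type_fact m))"
  have evn: "e = v + n"
    using weight_type[OF assms] by (simp add: e_def v_def n_def)
  obtain k where k: "k \<in> Poly_Mapping.keys m"
    using False by fastforce
  \<comment> \<open>Needed when \<open>r = 0\<close>: the truncated \<open>r + e - 1\<close> must be
    the predecessor of \<open>r + e\<close>.\<close>
  have "n > 0"
    using arg_cong[OF minus_single_add_single[OF k], of "weight (\<lambda>_. 1)"]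
    by (simp add: n_def weight_add)
  then have epos: "r + e > 0"
    by (simp add: evn)
  have "(\<Sum>k\<in>Poly_Mapping.keys m. pow_coeff (r + k) (m - Poly_Mapping.single k 1)) =
      (\<Sum>k\<in>Poly_Mapping.keys m. of_nat ((r + k) * Poly_Mapping.lookup m k) * q)"
    by (intro sum.cong refl) (simp only: pow_coeff_minus_single[OF assms] q_def e_def v_def)
  also have "\<dots> = of_nat (\<Sum>k\<in>Poly_Mapping.keys m. (r + k) * Poly_Mapping.lookup m k) * q"
    by (simp only: of_nat_sum sum_distrib_right)
  also have "(\<Sum>k\<in>Poly_Mapping.keys m. (r + k) * Poly_Mapping.lookup m k) = r * n + e"
    by (simp add: n_def e_def weight_def distrib_right sum.distrib sum_distrib_left)
  finally have sum: "(\<Sum>k\<in>Poly_Mapping.keys m.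
      pow_coeff (r + k) (m - Poly_Mapping.single k 1)) = of_nat (r * n + e) * q" .
  have "fact (r + e) = (of_nat (r + e) * fact (r + e - 1) :: rat)"
    using epos by (metis fact_reduce)
  then have 1: "pow_coeff (Suc r) m = of_nat (Suc r * (r + e)) * q"
    using False by (simp add: pow_coeff_def q_def e_def v_def distrib_right)
  have "fact (r + v + 1) = (of_nat (r + v + 1) * fact (r + v) :: rat)"
    by simp
  then have 2: "pow_coeff r m = of_nat (r * (r + v + 1)) * q"
    using False unfolding q_def
    by (simp add: pow_coeff_def e_def v_def del: of_nat_add of_nat_Suc fact_Suc mult_Suc_right)
  have "Suc r * (r + e) = r * (r + v + 1) + (r * n + e)"
    by (simp add: evn algebra_simps)
  then show ?thesis
    unfolding 1 2 sum by (metis of_nat_add distrib_right)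
qed (simp add: pow_coeff_def)

section \<open>The convolution identity\<close>

text \<open>Coefficient form of (sum of t_k F_k) G = sum of t_k (F_k G): one variable is taken out
  of the left part before or after splitting.\<close>

lemma sum_splits_minus_single:
  fixes f :: "'v \<Rightarrow> ('v \<Rightarrow>\<^sub>0 nat) \<Rightarrow> ('v \<Rightarrow>\<^sub>0 nat) \<Rightarrow> 'b :: comm_monoid_add"
  shows "(\<Sum>(a, b)\<in>splits m. \<Sum>k\<in>Poly_Mapping.keys a. f k (a - Poly_Mapping.single k 1) b) =
    (\<Sum>k\<in>Poly_Mapping.keys m. \<Sum>(a, b)\<in>splits (m - Poly_Mapping.single k 1). f k a b)"
proof -
  have "(\<Sum>(a, b)\<in>splits m. \<Sum>k\<in>Poly_Mapping.keys a. f k (a - Poly_Mapping.single k 1) b) =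
      (\<Sum>(x, k)\<in>Sigma (splits m) (\<lambda>x. Poly_Mapping.keys (fst x)).
        f k (fst x - Poly_Mapping.single k 1) (snd x))"
    unfolding case_prod_beta by (subst sum.Sigma) (auto simp: case_prod_beta)
  also have "\<dots> = (\<Sum>(k, x)\<in>Sigma (Poly_Mapping.keys m)
      (\<lambda>k. splits (m - Poly_Mapping.single k 1)). f k (fst x) (snd x))"
  proof (rule sum.reindex_bij_witness[where
        i = "\<lambda>(k, x). ((fst x + Poly_Mapping.single k 1, snd x), k)" and
        j = "\<lambda>(x, k). (k, (fst x - Poly_Mapping.single k 1, snd x))"], goal_cases)
    case (1 y)
    then show ?case
      by (auto simp: minus_single_add_single simp del: One_nat_def)
  next
    case (2 y)
    then obtain a b k where y: "y = ((a, b), k)" "a + b = m" "k \<in> Poly_Mapping.keys a"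
      by auto
    \<comment> \<open>Adding the unit vector back and cancelling it avoids computing with truncated
      subtraction.\<close>
    have "a - Poly_Mapping.single k 1 + b + Poly_Mapping.single k 1 = m"
      using minus_single_add_single[OF y(3)] y(2) by (metis add.assoc add.commute)
    then have "a - Poly_Mapping.single k 1 + b = m - Poly_Mapping.single k 1"
      by (metis add_diff_cancel_right')
    moreover have "k \<in> Poly_Mapping.keys m"
      using y by (auto simp: keys_add_nat)
    ultimately show ?case
      using y by simp
  next
    case (3 y)
    then show ?case by auto
  next
    case (4 y)
    then obtain a b k where y: "y = (k, (a, b))" "a + b = m - Poly_Mapping.single k 1"
      "k \<in> Poly_Mapping.keys m"
      by auto
    have "a + Poly_Mapping.single k 1 + b = m"
      using minus_single_add_single[OF y(3)] y(2) by (metis add.assoc add.commute)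
    then show ?case
      using y by (simp add: keys_add_nat)
  qed auto
  also have "\<dots> = (\<Sum>k\<in>Poly_Mapping.keys m.
      \<Sum>(a, b)\<in>splits (m - Poly_Mapping.single k 1). f k a b)"
    unfolding case_prod_beta by (subst sum.Sigma) (auto simp: case_prod_beta)
  finally show ?thesis .
qed

lemma pow_coeff_convolution:
  assumes "is_type m"
  shows "(\<Sum>(a, b)\<in>splits m. pow_coeff r a * pow_coeff s b) = pow_coeff (r + s) m"
  using assms
\<comment> \<open>\<open>r\<close> is generalised because the terms with one entry removed have
  \<open>r + k\<close> in place of \<open>r\<close>.\<close>
proof (induction "weight (\<lambda>_. 1) m" arbitrary: m r rule: less_induct)
  case less
  show ?case
  proof (induction r)
    case 0
    \<comment> \<open>\<open>pow_coeff 0\<close> is the coefficient function of the unit series, so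
      only the split with \<open>a = 0\<close> survives.\<close>
    have "(\<Sum>(a, b)\<in>splits m. pow_coeff 0 a * pow_coeff s b) =
        (\<Sum>(a, b)\<in>{(0, m)}. pow_coeff 0 a * pow_coeff s b)"
      by (rule sum.mono_neutral_right) (auto simp: pow_coeff_0 split: if_splits)
    then show ?case
      by (simp add: pow_coeff_0)
  next
    case (Suc r)
    have "(\<Sum>(a, b)\<in>splits m. pow_coeff (Suc r) a * pow_coeff s b) =
        (\<Sum>(a, b)\<in>splits m. pow_coeff r a * pow_coeff s b +
          (\<Sum>k\<in>Poly_Mapping.keys a.
            pow_coeff (r + k) (a - Poly_Mapping.single k 1) * pow_coeff s b))"
    proof (intro sum.cong refl, clarify)
      fix a b assume "(a, b) \<in> splits m"
      then have "is_type a"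
        using less.prems is_type_add by auto
      then show "pow_coeff (Suc r) a * pow_coeff s b = pow_coeff r a * pow_coeff s b +
          (\<Sum>k\<in>Poly_Mapping.keys a.
            pow_coeff (r + k) (a - Poly_Mapping.single k 1) * pow_coeff s b)"
        by (simp only: pow_coeff_Suc distrib_right sum_distrib_right)
    qed
    \<comment> \<open>The first summand is settled by the inner induction on \<open>r\<close>; the
      others have smaller multiplicity and fall to the outer one.\<close>
    also have "\<dots> = pow_coeff (r + s) m + (\<Sum>k\<in>Poly_Mapping.keys m.
        \<Sum>(a, b)\<in>splits (m - Poly_Mapping.single k 1). pow_coeff (r + k) a * pow_coeff s b)"
      unfolding Suc.IH[symmetric] sum_splits_minus_single[symmetric]
      by (simp add: case_prod_beta sum.distrib)
    also have "(\<Sum>k\<in>Poly_Mapping.keys m.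
        \<Sum>(a, b)\<in>splits (m - Poly_Mapping.single k 1). pow_coeff (r + k) a * pow_coeff s b) =
        (\<Sum>k\<in>Poly_Mapping.keys m. pow_coeff (r + s + k) (m - Poly_Mapping.single k 1))"
    proof (intro sum.cong refl)
      fix k assume k: "k \<in> Poly_Mapping.keys m"
      let ?m' = "m - Poly_Mapping.single k 1"
      have m: "?m' + Poly_Mapping.single k 1 = m"
        by (rule minus_single_add_single[OF k])
      have "weight (\<lambda>_. 1) ?m' + 1 = weight (\<lambda>_. 1) m"
        using arg_cong[OF m, of "weight (\<lambda>_. 1)"] by (simp add: weight_add)
      moreover have "is_type ?m'"
        using less.prems m is_type_add by metis
      ultimately have "(\<Sum>(a, b)\<in>splits ?m'. pow_coeff (r + k) a * pow_coeff s b) =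
          pow_coeff (r + k + s) ?m'"
        by (intro less.hyps) auto
      then show "(\<Sum>(a, b)\<in>splits ?m'. pow_coeff (r + k) a * pow_coeff s b) =
          pow_coeff (r + s + k) ?m'"
        by (simp add: ac_simps)
    qed
    also have "pow_coeff (r + s) m + \<dots> = pow_coeff (Suc r + s) m"
      using pow_coeff_Suc[OF less.prems, of "r + s"] by simp
    finally show ?case .
  qed
qed

section \<open>Coefficients of the powers of S\<close>

lemma E_weight: "E m = 1 + weight (\<lambda>k. k) m"
  by (simp add: E_def weight_def)

lemma V_weight: "V m = 2 + weight (\<lambda>k. k - 1) m"
  by (simp add: V_def weight_def)

lemma mcoeff_S: "is_type m \<Longrightarrow> mcoeff S m = pow_coeff 1 m"
  by (simp add: S_def Abs_mpow_series_inverse C_def pow_coeff_pos E_weight V_weight)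

lemma mcoeff_S_power:
  assumes "is_type m"
  shows "mcoeff (S ^ r) m = pow_coeff r m"
  using assms
proof (induction r arbitrary: m)
  case 0
  then show ?case
    by (simp add: one_mpow_series.rep_eq pow_coeff_0)
next
  case (Suc r)
  have "mcoeff (S ^ Suc r) m = (\<Sum>(a, b)\<in>splits m. pow_coeff 1 a * pow_coeff r b)"
    unfolding power_Suc times_mpow_series.rep_eq
    \<comment> \<open>Only types occur in the splits, so the zero coefficients of \<open>S\<close>
      at other vectors never enter.\<close>
    using Suc.prems by (intro sum.cong refl) (auto simp: is_type_add mcoeff_S Suc.IH)
  also have "\<dots> = pow_coeff (Suc r) m"
    using pow_coeff_convolution[OF Suc.prems, of 1 r] by simp
  finally show ?case .
qed

theorem theorem7:
  fixes r :: nat and m :: "nat \<Rightarrow>\<^sub>0 nat"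
  assumes "r \<ge> 2" and "is_type m"
  shows "mcoeff (S ^ r) m =
           of_nat r * fact (r - 2 + E m) / (fact (r - 2 + V m) * of_nat (type_fact m)) \<and>
         of_nat r * fact (r - 2 + E m) / (fact (r - 2 + V m) * of_nat (type_fact m)) =
           (of_nat r * fact (r - 1 + (\<Sum>k\<in>Poly_Mapping.keys m. k * Poly_Mapping.lookup m k)) /
            (fact (r + (\<Sum>k\<in>Poly_Mapping.keys m. (k - 1) * Poly_Mapping.lookup m k)) *
             (\<Prod>k\<in>Poly_Mapping.keys m. fact (Poly_Mapping.lookup m k))) :: rat)"
proof -
  \<comment> \<open>\<open>r \<ge> 2\<close> makes the subtractions \<open>r - 2\<close> and
    \<open>r - 1\<close> exact.\<close>
  have e: "r - 2 + E m = r - 1 + weight (\<lambda>k. k) m"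
      "r + weight (\<lambda>k. k) m - 1 = r - 1 + weight (\<lambda>k. k) m"
    and v: "r - 2 + V m = r + weight (\<lambda>k. k - 1) m"
    using assms(1) by (simp_all add: E_weight V_weight)
  have t: "of_nat (type_fact m) =
      (\<Prod>k\<in>Poly_Mapping.keys m. fact (Poly_Mapping.lookup m k) :: rat)"
    by (simp add: type_fact_def)
  have "r > 0"
    using assms(1) by simp
  then show ?thesis
    unfolding mcoeff_S_power[OF assms(2)] pow_coeff_pos[OF \<open>r > 0\<close>] e v
    by (simp add: t weight_def)
qed

end
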